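(* For every derivation in $\mathsf{SKS}$ with premise $T$ and conclusion $R$ there are structures $V$ and $U$ and a derivation from $T$ to $R$ composed, from top to bottom, of: a derivation from $T$ to $V$ in $\{ac{\uparrow}\}$, a derivation from $V$ to $U$ in $\mathsf{SKS}\setminus\{ac{\downarrow},ac{\uparrow}\}$, and a derivation from $U$ to $R$ in $\{ac{\downarrow}\}$.
   Context: Structures: generated by $S ::= \mathsf f \mid \mathsf t \mid a \mid [S,\dots,S] \mid (S,\dots,S) \mid \bar S$ (non-empty lists), where $a$ ranges over atoms, $\mathsf f,\mathsf t$ are the units false and true, $[\cdot]$ is disjunction, $(\cdot)$ is conjunction, $\bar S$ is negation; the negation of an atom is again an atom. A context $S\{\ \}$ is a structure with one occurrence of a hole, not in the scope of a negation; $S\{R\}$ is the result of filling it with $R$; $S[R,T]$ abbreviates $S\{[R,T]\}$ and $S(R,T)$ abbreviates $S\{(R,T)\}$. Equivalent structures are not distinguished; equivalence is the smallest equivalence relation induced by: $[\vec R,[\vec T],\vec U]=[\vec R,\vec T,\vec U]$ and $(\vec R,(\vec T),\vec U)=(\vec R,\vec T,\vec U)$ (with $\vec R,\vec T,\vec U$ finite sequences, $\vec T$ non-empty); $[R,T]=[T,R]$, $(R,T)=(T,R)$; $(\mathsf f,\mathsf f)=\mathsf f$, $[\mathsf f,R]=R$, $[\mathsf t,\mathsf t]=\mathsf t$, $(\mathsf t,R)=R$; $\bar{\mathsf f}=\mathsf t$, $\bar{\mathsf t}=\mathsf f$, $\overline{[R,T]}=(\bar R,\bar T)$, $\overline{(R,T)}=[\bar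 R,\bar T]$, $\bar{\bar R}=R$; and closure: if $R=T$ then $S\{R\}=S\{T\}$ and $\bar R=\bar T$. A derivation in a system (set of inference rules) is a finite sequence of rule instances, read top-down, the conclusion of each being the premise of the next; it may consist of a single structure. Its premise is the topmost structure, its conclusion the bottommost. System $\mathsf{SKS}$ has the rules (written $\frac{\text{premise}}{\text{conclusion}}$, for atoms $a$, structures $R,T,U,V$ and contexts $S\{\ \}$): $ai{\downarrow}:\frac{S\{\mathsf t\}}{S[a,\bar a]}$, $ai{\uparrow}:\frac{S(a,\bar a)}{S\{\mathsf f\}}$, $s:\frac{S([R,U],T)}{S[(R,T),U]}$, $m:\frac{S[(R,U),(T,V)]}{S([R,T],[U,V])}$, $aw{\downarrow}:\frac{S\{\mathsf f\}}{S\{a\}}$, $aw{\uparrow}:\frac{S\{a\}}{S\{\mathsf t\}}$, $ac{\downarrow}:\frac{S[a,a]}{S\{a\}}$, $ac{\uparrow}:\frac{S\{a\}}{S(a,a)}$. *)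

theory Defs
  imports Main
begin

text \<open>Atoms come in complementary pairs, so that the negation of an atom is a different atom
  and negating twice gives the atom back. Both members of a pair are atoms in
  the sense of the grammar and of the inference rules.\<close>

datatype 'v atom = Pos 'v | Neg 'v

fun atom_neg :: "'v atom \<Rightarrow> 'v atom" where
  "atom_neg (Pos v) = Neg v"
| "atom_neg (Neg v) = Pos v"

text \<open>The lists in disjunctions and conjunctions are non-empty, hence the separate first element.\<close>

datatype 'v struct =
    Ff
  | Tt
  | Atom "'v atom"
  | Or "'v struct" "'v struct list"
  | And "'v struct" "'v struct list"
  | Bar "'v struct"

text \<open>List views of the two constructors; they are only ever applied to non-empty lists.\<close>

definition disj :: "'v struct list \<Rightarrow> 'v struct" where
  "disj Ss = Or (hd Ss) (tl Ss)"

definition conj :: "'v struct list \<Rightarrow> 'v struct" where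
  "conj Ss = And (hd Ss) (tl Ss)"

text \<open>There is no constructor for \<^const>\<open>Bar\<close>: the hole is never in the scope of a negation.\<close>

datatype 'v ctxt =
    Hole
  | Or_ctxt "'v struct list" "'v ctxt" "'v struct list"
  | And_ctxt "'v struct list" "'v ctxt" "'v struct list"

fun fill :: "'v ctxt \<Rightarrow> 'v struct \<Rightarrow> 'v struct" where
  "fill Hole X = X"
| "fill (Or_ctxt Rs S Us) X = disj (Rs @ fill S X # Us)"
| "fill (And_ctxt Rs S Us) X = conj (Rs @ fill S X # Us)"

text \<open>Rule \<open>bar_atom\<close> identifies the structure negation of an atom with the complementary atom.\<close>

inductive struct_eq :: "'v struct \<Rightarrow> 'v struct \<Rightarrow> bool" (infix "\<approx>" 50) where
  refl: "R \<approx> R"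
| sym: "R \<approx> T \<Longrightarrow> T \<approx> R"
| trans: "R \<approx> T \<Longrightarrow> T \<approx> U \<Longrightarrow> R \<approx> U"
| disj_assoc: "Ts \<noteq> [] \<Longrightarrow> disj (Rs @ [disj Ts] @ Us) \<approx> disj (Rs @ Ts @ Us)"
| conj_assoc: "Ts \<noteq> [] \<Longrightarrow> conj (Rs @ [conj Ts] @ Us) \<approx> conj (Rs @ Ts @ Us)"
| disj_comm: "disj [R, T] \<approx> disj [T, R]"
| conj_comm: "conj [R, T] \<approx> conj [T, R]"
| conj_ff: "conj [Ff, Ff] \<approx> Ff"
| disj_ff: "disj [Ff, R] \<approx> R"
| disj_tt: "disj [Tt, Tt] \<approx> Tt"
| conj_tt: "conj [Tt, R] \<approx> R"
| bar_ff: "Bar Ff \<approx> Tt"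
| bar_tt: "Bar Tt \<approx> Ff"
| bar_atom: "Bar (Atom a) \<approx> Atom (atom_neg a)"
| bar_disj: "Bar (disj [R, T]) \<approx> conj [Bar R, Bar T]"
| bar_conj: "Bar (conj [R, T]) \<approx> disj [Bar R, Bar T]"
| bar_bar: "Bar (Bar R) \<approx> R"
| fill_cong: "R \<approx> T \<Longrightarrow> fill S R \<approx> fill S T"
| bar_cong: "R \<approx> T \<Longrightarrow> Bar R \<approx> Bar T"

datatype rule =
  Ai_down | Ai_up | Switch | Medial | Aw_down | Aw_up | Ac_down | Ac_up

text \<open>\<open>rule_instance r P Q\<close>: the step with premise \<open>P\<close> and conclusion \<open>Q\<close> is an instance of \<open>r\<close>.\<close>

inductive rule_instance :: "rule \<Rightarrow> 'v struct \<Rightarrow> 'v struct \<Rightarrow> bool" where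
  "rule_instance Ai_down (fill S Tt) (fill S (disj [Atom a, Bar (Atom a)]))"
| "rule_instance Ai_up (fill S (conj [Atom a, Bar (Atom a)])) (fill S Ff)"
| "rule_instance Switch
     (fill S (conj [disj [R, U], T]))
     (fill S (disj [conj [R, T], U]))"
| "rule_instance Medial
     (fill S (disj [conj [R, U], conj [T, V]]))
     (fill S (conj [disj [R, T], disj [U, V]]))"
| "rule_instance Aw_down (fill S Ff) (fill S (Atom a))"
| "rule_instance Aw_up (fill S (Atom a)) (fill S Tt)"
| "rule_instance Ac_down (fill S (disj [Atom a, Atom a])) (fill S (Atom a))"
| "rule_instance Ac_up (fill S (Atom a)) (fill S (conj [Atom a, Atom a]))"

definition SKS :: "rule set" where
  "SKS = {Ai_down, Ai_up, Switch, Medial, Aw_down, Aw_up, Ac_down, Ac_up}"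

text \<open>\<open>derivation \<S> T \<Delta> R\<close>: the sequence \<open>\<Delta>\<close> of rule instances (rule, premise, conclusion),
  listed from top to bottom, is a derivation from \<open>T\<close> to \<open>R\<close> in the system \<open>\<S>\<close>.
  Equivalent structures are not distinguished, so adjacent structures need only
  agree up to equivalence. The empty sequence is the derivation consisting of a single structure.\<close>

fun derivation ::
  "rule set \<Rightarrow> 'v struct \<Rightarrow> (rule \<times> 'v struct \<times> 'v struct) list \<Rightarrow> 'v struct \<Rightarrow> bool" where
  "derivation \<S> T [] R \<longleftrightarrow> T \<approx> R"
| "derivation \<S> T ((r, P, Q) # \<Delta>) R \<longleftrightarrow>
     T \<approx> P \<and> r \<in> \<S> \<and> rule_instance r P Q \<and> derivation \<S> Q \<Delta> R"

end

theory Submission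
  imports Defs
begin

text \<open>
  Soundness reduces the theorem to a completeness statement: if \<open>T\<close> entails \<open>R\<close>, then the
  disjunction of the negation of \<open>T\<close> with \<open>R\<close> is valid, and contractions can be confined to the
  bottom of a proof of it. In a backward sequent-style proof search, contraction is only needed
  because the conjunction rule duplicates the side formulas; medial merges the two copies into one
  copy in which every atom is replaced by a disjunction of copies of itself (an inflation), and
  only these atoms have to be contracted. The contractions below the negation of \<open>T\<close> are then
  flipped to cocontractions at the top, using switch and cut.
\<close>

section \<open>Derivability\<close>

text \<open>The list of rule instances is hidden so that derivability becomes a transitive relation
  usable in \<open>also\<close> chains; the lists are recovered only at the very end.\<close>

definition derivable :: "rule set \<Rightarrow> 'v struct \<Rightarrow> 'v struct \<Rightarrow> bool" where
  "derivable \<S> P Q \<longleftrightarrow> (\<exists>\<Delta>. derivation \<S> P \<Delta> Q)"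

lemma derivation_eq_left: "P' \<approx> P \<Longrightarrow> derivation \<S> P \<Delta> Q \<Longrightarrow> derivation \<S> P' \<Delta> Q"
  by (cases \<Delta>) (auto elim: struct_eq.trans)

lemma derivation_append:
  "derivation \<S> P \<Delta> Q \<Longrightarrow> derivation \<S> Q \<Delta>' R \<Longrightarrow> derivation \<S> P (\<Delta> @ \<Delta>') R"
  by (induction \<S> P \<Delta> Q rule: derivation.induct) (simp, erule (1) derivation_eq_left, simp)

lemma derivation_mono: "\<S> \<subseteq> \<S>' \<Longrightarrow> derivation \<S> P \<Delta> Q \<Longrightarrow> derivation \<S>' P \<Delta> Q"
  by (induction \<S> P \<Delta> Q rule: derivation.induct) auto

lemma derivable_eq: "P \<approx> Q \<Longrightarrow> derivable \<S> P Q"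
  unfolding derivable_def by (rule exI[of _ "[]"]) simp

lemma derivable_eq_sym: "Q \<approx> P \<Longrightarrow> derivable \<S> P Q"
  by (rule derivable_eq, erule struct_eq.sym)

lemma derivable_refl: "derivable \<S> P P"
  by (intro derivable_eq struct_eq.refl)

lemma derivable_trans [trans]: "derivable \<S> P Q \<Longrightarrow> derivable \<S> Q R \<Longrightarrow> derivable \<S> P R"
  unfolding derivable_def by (elim exE, rule exI, erule (1) derivation_append)

lemma derivable_rule: "r \<in> \<S> \<Longrightarrow> rule_instance r P Q \<Longrightarrow> derivable \<S> P Q"
  unfolding derivable_def by (rule exI[of _ "[(r, P, Q)]"]) (simp add: struct_eq.refl)

section \<open>Closure of derivability under contexts\<close>

fun ctxt_comp :: "'v ctxt \<Rightarrow> 'v ctxt \<Rightarrow> 'v ctxt" where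
  "ctxt_comp Hole D = D"
| "ctxt_comp (Or_ctxt Rs C Us) D = Or_ctxt Rs (ctxt_comp C D) Us"
| "ctxt_comp (And_ctxt Rs C Us) D = And_ctxt Rs (ctxt_comp C D) Us"

lemma fill_ctxt_comp: "fill C (fill D X) = fill (ctxt_comp C D) X"
  by (induction C) auto

text \<open>Every rule is stated under an arbitrary context, so a further context around an instance
  is absorbed by composing the two.\<close>

lemma rule_instance_fill: "rule_instance r P Q \<Longrightarrow> rule_instance r (fill C P) (fill C Q)"
  by (induction rule: rule_instance.induct) (auto simp: fill_ctxt_comp intro: rule_instance.intros)

lemma derivable_fill:
  assumes "derivable \<S> P Q"
  shows "derivable \<S> (fill C P) (fill C Q)"
proof -
  obtain \<Delta> where "derivation \<S> P \<Delta> Q"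
    using assms unfolding derivable_def by blast
  then show ?thesis
  proof (induction \<S> P \<Delta> Q rule: derivation.induct)
    case (1 \<S> P R)
    then show ?case by (auto intro: derivable_eq struct_eq.fill_cong)
  next
    case (2 \<S> P r P' Q \<Delta> R)
    have "derivable \<S> (fill C P) (fill C P')"
      using 2 by (auto intro: derivable_eq struct_eq.fill_cong)
    also have "derivable \<S> \<dots> (fill C Q)"
      using 2 by (auto intro: derivable_rule rule_instance_fill)
    also have "derivable \<S> \<dots> (fill C R)"
      using 2 by auto
    finally show ?case .
  qed
qed

lemma derivable_disj:
  assumes "derivable \<S> P P'" "derivable \<S> Q Q'"
  shows "derivable \<S> (disj [P, Q]) (disj [P', Q'])"
  using derivable_fill[OF assms(1), of "Or_ctxt [] Hole [Q]"]
    derivable_fill[OF assms(2), of "Or_ctxt [P'] Hole []"]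
  by (simp add: derivable_trans[of _ _ "disj [P', Q]"])

lemma derivable_conj:
  assumes "derivable \<S> P P'" "derivable \<S> Q Q'"
  shows "derivable \<S> (conj [P, Q]) (conj [P', Q'])"
  using derivable_fill[OF assms(1), of "And_ctxt [] Hole [Q]"]
    derivable_fill[OF assms(2), of "And_ctxt [P'] Hole []"]
  by (simp add: derivable_trans[of _ _ "conj [P', Q]"])

lemmas rule_at_root = rule_instance.intros[where S = Hole, simplified]

section \<open>Equivalence of binary structures\<close>

declare struct_eq.trans [trans]

lemma disj_cong: "P \<approx> P' \<Longrightarrow> Q \<approx> Q' \<Longrightarrow> disj [P, Q] \<approx> disj [P', Q']"
  using struct_eq.fill_cong[of P P' "Or_ctxt [] Hole [Q]"]
    struct_eq.fill_cong[of Q Q' "Or_ctxt [P'] Hole []"]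
  by (simp add: struct_eq.trans[of _ "disj [P', Q]"])

lemma conj_cong: "P \<approx> P' \<Longrightarrow> Q \<approx> Q' \<Longrightarrow> conj [P, Q] \<approx> conj [P', Q']"
  using struct_eq.fill_cong[of P P' "And_ctxt [] Hole [Q]"]
    struct_eq.fill_cong[of Q Q' "And_ctxt [P'] Hole []"]
  by (simp add: struct_eq.trans[of _ "conj [P', Q]"])

lemma disj_assoc2: "disj [disj [P, Q], R] \<approx> disj [P, disj [Q, R]]"
  using struct_eq.trans[OF struct_eq.disj_assoc[of "[P, Q]" "[]" "[R]", simplified]
      struct_eq.disj_assoc[of "[Q, R]" "[P]" "[]", simplified, THEN struct_eq.sym]] .

lemma conj_assoc2: "conj [conj [P, Q], R] \<approx> conj [P, conj [Q, R]]"
  using struct_eq.trans[OF struct_eq.conj_assoc[of "[P, Q]" "[]" "[R]", simplified]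
      struct_eq.conj_assoc[of "[Q, R]" "[P]" "[]", simplified, THEN struct_eq.sym]] .

lemma disj_left_comm: "disj [P, disj [Q, R]] \<approx> disj [Q, disj [P, R]]"
proof -
  have "disj [P, disj [Q, R]] \<approx> disj [disj [P, Q], R]"
    by (rule struct_eq.sym[OF disj_assoc2])
  also have "\<dots> \<approx> disj [disj [Q, P], R]"
    by (rule disj_cong[OF struct_eq.disj_comm struct_eq.refl])
  also have "\<dots> \<approx> disj [Q, disj [P, R]]"
    by (rule disj_assoc2)
  finally show ?thesis .
qed

lemma disj_exchange: "disj [disj [P, Q], disj [R, S]] \<approx> disj [disj [P, R], disj [Q, S]]"
proof -
  have "disj [disj [P, Q], disj [R, S]] \<approx> disj [P, disj [Q, disj [R, S]]]"
    by (rule disj_assoc2)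
  also have "\<dots> \<approx> disj [P, disj [R, disj [Q, S]]]"
    by (rule disj_cong[OF struct_eq.refl disj_left_comm])
  also have "\<dots> \<approx> disj [disj [P, R], disj [Q, S]]"
    by (rule struct_eq.sym[OF disj_assoc2])
  finally show ?thesis .
qed

lemma disj_ff_right: "disj [R, Ff] \<approx> R"
  by (rule struct_eq.trans[OF struct_eq.disj_comm struct_eq.disj_ff])

lemma conj_tt_right: "conj [R, Tt] \<approx> R"
  by (rule struct_eq.trans[OF struct_eq.conj_comm struct_eq.conj_tt])

text \<open>The defining equations reach singletons only through associativity: padding the element
  to \<open>disj [Ff, R]\<close> creates a nested disjunction that flattens to a two-element list,
  where the unit law applies.\<close>

lemma disj_singleton: "disj [R] \<approx> R"
proof -
  have "disj [R] \<approx> disj [disj [Ff, R]]"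
    using struct_eq.fill_cong[OF struct_eq.sym[OF struct_eq.disj_ff], of "Or_ctxt [] Hole []" R]
    by simp
  also have "\<dots> \<approx> disj [Ff, R]"
    using struct_eq.disj_assoc[of "[Ff, R]" "[]" "[]"] by simp
  also have "\<dots> \<approx> R"
    by (rule struct_eq.disj_ff)
  finally show ?thesis .
qed

lemma conj_singleton: "conj [R] \<approx> R"
proof -
  have "conj [R] \<approx> conj [conj [Tt, R]]"
    using struct_eq.fill_cong[OF struct_eq.sym[OF struct_eq.conj_tt], of "And_ctxt [] Hole []" R]
    by simp
  also have "\<dots> \<approx> conj [Tt, R]"
    using struct_eq.conj_assoc[of "[Tt, R]" "[]" "[]"] by simp
  also have "\<dots> \<approx> R"
    by (rule struct_eq.conj_tt)
  finally show ?thesis .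
qed

lemma disj_Cons_Cons: "disj (P # Q # Rs) \<approx> disj [P, disj (Q # Rs)]"
  using struct_eq.disj_assoc[of "Q # Rs" "[P]" "[]", THEN struct_eq.sym] by simp

lemma conj_Cons_Cons: "conj (P # Q # Rs) \<approx> conj [P, conj (Q # Rs)]"
  using struct_eq.conj_assoc[of "Q # Rs" "[P]" "[]", THEN struct_eq.sym] by simp

section \<open>Negation normal forms\<close>

text \<open>Binary, negation-free representatives of structures modulo equivalence. They permit
  plain structural induction, without lists or \<open>Bar\<close>.\<close>

datatype 'v nnf =
    NFf
  | NTt
  | NAtom "'v atom"
  | NOr "'v nnf" "'v nnf"
  | NAnd "'v nnf" "'v nnf"

primrec struct_of :: "'v nnf \<Rightarrow> 'v struct" where
  "struct_of NFf = Ff"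
| "struct_of NTt = Tt"
| "struct_of (NAtom a) = Atom a"
| "struct_of (NOr M N) = disj [struct_of M, struct_of N]"
| "struct_of (NAnd M N) = conj [struct_of M, struct_of N]"

primrec neg :: "'v nnf \<Rightarrow> 'v nnf" where
  "neg NFf = NTt"
| "neg NTt = NFf"
| "neg (NAtom a) = NAtom (atom_neg a)"
| "neg (NOr M N) = NAnd (neg M) (neg N)"
| "neg (NAnd M N) = NOr (neg M) (neg N)"

lemma atom_neg_atom_neg [simp]: "atom_neg (atom_neg a) = a"
  by (cases a) auto

lemma neg_neg [simp]: "neg (neg N) = N"
  by (induction N) auto

lemma Bar_struct_of: "Bar (struct_of N) \<approx> struct_of (neg N)"
  \<comment> \<open>The numbered introduction rules are \<open>bar_ff\<close>, \<open>bar_tt\<close>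
    and \<open>bar_atom\<close>; compound cases are the De Morgan laws.\<close>
  by (induction N)
    (auto intro: struct_eq.intros(12-14) struct_eq.trans[OF struct_eq.bar_disj]
      struct_eq.trans[OF struct_eq.bar_conj] conj_cong disj_cong)

lemma nnf_disj:
  "\<forall>x \<in> set (x # xs). \<exists>N. struct_of N \<approx> x \<Longrightarrow> \<exists>N. struct_of N \<approx> disj (x # xs)"
proof (induction xs arbitrary: x)
  case Nil
  then show ?case using struct_eq.trans[OF _ struct_eq.sym[OF disj_singleton]] by fastforce
next
  case (Cons y ys)
  obtain M where "struct_of M \<approx> x"
    using Cons.prems by auto
  moreover obtain N where "struct_of N \<approx> disj (y # ys)"
    using Cons.IH[of y] Cons.prems by (metis list.set_intros(2))
  ultimately have "struct_of (NOr M N) \<approx> disj (x # y # ys)"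
    by (simp add: struct_eq.trans[OF disj_cong struct_eq.sym[OF disj_Cons_Cons]])
  then show ?case by blast
qed

lemma nnf_conj:
  "\<forall>x \<in> set (x # xs). \<exists>N. struct_of N \<approx> x \<Longrightarrow> \<exists>N. struct_of N \<approx> conj (x # xs)"
proof (induction xs arbitrary: x)
  case Nil
  then show ?case using struct_eq.trans[OF _ struct_eq.sym[OF conj_singleton]] by fastforce
next
  case (Cons y ys)
  obtain M where "struct_of M \<approx> x"
    using Cons.prems by auto
  moreover obtain N where "struct_of N \<approx> conj (y # ys)"
    using Cons.IH[of y] Cons.prems by (metis list.set_intros(2))
  ultimately have "struct_of (NAnd M N) \<approx> conj (x # y # ys)"
    by (simp add: struct_eq.trans[OF conj_cong struct_eq.sym[OF conj_Cons_Cons]])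
  then show ?case by blast
qed

text \<open>Lists become right-nested binary connectives, and a \<open>Bar\<close> is removed by
  negating the normal form found for its argument.\<close>

lemma ex_nnf: "\<exists>N. struct_of N \<approx> P"
proof (induction P)
  case Ff
  show ?case using struct_eq.refl by (metis struct_of.simps(1))
next
  case Tt
  show ?case using struct_eq.refl by (metis struct_of.simps(2))
next
  case (Atom a)
  show ?case using struct_eq.refl by (metis struct_of.simps(3))
next
  case (Or x xs)
  then show ?case using nnf_disj[of x xs] by (auto simp: disj_def)
next
  case (And x xs)
  then show ?case using nnf_conj[of x xs] by (auto simp: conj_def)
next
  case (Bar P)
  then show ?case
    using struct_eq.trans[OF struct_eq.sym[OF Bar_struct_of] struct_eq.bar_cong] by blast
qed

section \<open>Soundness\<close>

primrec eval_atom :: "('v \<Rightarrow> bool) \<Rightarrow> 'v atom \<Rightarrow> bool" where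
  "eval_atom v (Pos x) = v x"
| "eval_atom v (Neg x) = (\<not> v x)"

lemma eval_atom_neg [simp]: "eval_atom v (atom_neg a) \<longleftrightarrow> \<not> eval_atom v a"
  by (cases a) auto

fun eval_struct :: "('v \<Rightarrow> bool) \<Rightarrow> 'v struct \<Rightarrow> bool" where
  "eval_struct v Ff = False"
| "eval_struct v Tt = True"
| "eval_struct v (Atom a) = eval_atom v a"
| "eval_struct v (Or R Rs) = (eval_struct v R \<or> (\<exists>x \<in> set Rs. eval_struct v x))"
| "eval_struct v (And R Rs) = (eval_struct v R \<and> (\<forall>x \<in> set Rs. eval_struct v x))"
| "eval_struct v (Bar R) = (\<not> eval_struct v R)"

lemma eval_struct_disj [simp]:
  "Rs \<noteq> [] \<Longrightarrow> eval_struct v (disj Rs) \<longleftrightarrow> (\<exists>x \<in> set Rs. eval_struct v x)"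
  by (cases Rs) (auto simp: disj_def)

lemma eval_struct_conj [simp]:
  "Rs \<noteq> [] \<Longrightarrow> eval_struct v (conj Rs) \<longleftrightarrow> (\<forall>x \<in> set Rs. eval_struct v x)"
  by (cases Rs) (auto simp: conj_def)

text \<open>The hole is never under a negation, so contexts are monotone; soundness of a rule at the
  root therefore carries over to every depth.\<close>

lemma eval_struct_fill_mono:
  "(eval_struct v P \<Longrightarrow> eval_struct v Q) \<Longrightarrow> eval_struct v (fill C P) \<Longrightarrow> eval_struct v (fill C Q)"
  by (induction C) auto

lemma eval_struct_eq: "P \<approx> Q \<Longrightarrow> eval_struct v P = eval_struct v Q"
proof (induction rule: struct_eq.induct)
  case (fill_cong P Q C)
  then show ?case using eval_struct_fill_mono by blast
qed auto

lemma rule_instance_sound: "rule_instance r P Q \<Longrightarrow> eval_struct v P \<Longrightarrow> eval_struct v Q"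
  by (induction rule: rule_instance.induct) (auto elim!: eval_struct_fill_mono[rotated])

lemma derivation_sound: "derivation \<S> P \<Delta> Q \<Longrightarrow> eval_struct v P \<Longrightarrow> eval_struct v Q"
  by (induction \<S> P \<Delta> Q rule: derivation.induct)
    (auto simp: eval_struct_eq dest: rule_instance_sound)

abbreviation eval_nnf :: "('v \<Rightarrow> bool) \<Rightarrow> 'v nnf \<Rightarrow> bool" where
  "eval_nnf v N \<equiv> eval_struct v (struct_of N)"

lemma eval_nnf_neg: "eval_nnf v (neg N) \<longleftrightarrow> \<not> eval_nnf v N"
  using eval_struct_eq[OF Bar_struct_of, of v N] by simp

section \<open>Inflations\<close>

text \<open>An atom may be replaced by any tree of disjunctions over copies of itself, while
  compound formulas keep their outer connective. Duplication happens only at atoms, so atomic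
  contractions alone can undo it.\<close>

inductive inflation :: "'v nnf \<Rightarrow> 'v nnf \<Rightarrow> bool" where
  ff: "inflation NFf NFf"
| tt: "inflation NTt NTt"
| atom: "inflation (NAtom a) (NAtom a)"
| dup: "inflation M (NAtom a) \<Longrightarrow> inflation M' (NAtom a) \<Longrightarrow> inflation (NOr M M') (NAtom a)"
| disj: "inflation M' M \<Longrightarrow> inflation N' N \<Longrightarrow> inflation (NOr M' N') (NOr M N)"
| conj: "inflation M' M \<Longrightarrow> inflation N' N \<Longrightarrow> inflation (NAnd M' N') (NAnd M N)"

inductive_cases inflation_ffE: "inflation M NFf"
inductive_cases inflation_ttE: "inflation M NTt"
inductive_cases inflation_disjE: "inflation K (NOr M N)"
inductive_cases inflation_conjE: "inflation K (NAnd M N)"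

lemma inflation_refl: "inflation N N"
  by (induction N) (auto intro: inflation.intros)

lemma inflation_ac_down: "inflation M N \<Longrightarrow> derivable {Ac_down} (struct_of M) (struct_of N)"
proof (induction rule: inflation.induct)
  case (dup M a M')
  then have "derivable {Ac_down} (disj [struct_of M, struct_of M']) (disj [Atom a, Atom a])"
    by (auto intro: derivable_disj)
  also have "derivable {Ac_down} \<dots> (Atom a)"
    by (rule derivable_rule[OF _ rule_at_root(7)]) simp
  finally show ?case by simp
qed (auto intro: derivable_refl derivable_disj derivable_conj)

text \<open>Negation turns a disjunction of copies of \<open>a\<close> into a conjunction of copies
  of its complement, which is exactly what cocontraction produces.\<close>

lemma inflation_ac_up:
  "inflation M N \<Longrightarrow> derivable {Ac_up} (struct_of (neg N)) (struct_of (neg M))"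
proof (induction rule: inflation.induct)
  case (dup M a M')
  have "derivable {Ac_up} (Atom (atom_neg a)) (conj [Atom (atom_neg a), Atom (atom_neg a)])"
    by (rule derivable_rule[OF _ rule_at_root(8)]) simp
  also have "derivable {Ac_up} \<dots> (conj [struct_of (neg M), struct_of (neg M')])"
    using dup by (auto intro: derivable_conj)
  finally show ?case by simp
qed (auto intro: derivable_refl derivable_disj derivable_conj)

section \<open>Merging two inflations of one formula without contraction\<close>

abbreviation contraction_free :: "rule set" where
  "contraction_free \<equiv> SKS - {Ac_down, Ac_up}"

lemma derivable_cf_rules:
  "derivable contraction_free Tt (disj [Atom a, Bar (Atom a)])"
  "derivable contraction_free (conj [Atom a, Bar (Atom a)]) Ff"
  "derivable contraction_free (conj [disj [R, U], T]) (disj [conj [R, T], U])"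
  "derivable contraction_free (disj [conj [R, U], conj [T, V]]) (conj [disj [R, T], disj [U, V]])"
  "derivable contraction_free Ff (Atom a)"
  by (rule derivable_rule[OF _ rule_at_root(1)] derivable_rule[OF _ rule_at_root(2)]
      derivable_rule[OF _ rule_at_root(3)] derivable_rule[OF _ rule_at_root(4)]
      derivable_rule[OF _ rule_at_root(5)], simp add: SKS_def)+

text \<open>Both inflations have the shape of \<open>N\<close> down to its atoms. Medial pushes the
  outer disjunction through a conjunction, associativity and commutativity push it through a
  disjunction, and units collapse by equivalence. At an atom the disjunction is itself an inflation,
  so the contraction is merely postponed.\<close>

lemma inflation_merge:
  assumes "inflation M N" "inflation M' N"
  shows "\<exists>K. inflation K N \<and>
    derivable contraction_free (disj [struct_of M, struct_of M']) (struct_of K)"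
  using assms
proof (induction N arbitrary: M M' rule: nnf.induct)
  case NFf
  then have "M = NFf" "M' = NFf"
    by (auto elim: inflation_ffE)
  then show ?case
    using inflation.ff derivable_eq[OF struct_eq.disj_ff] by fastforce
next
  case NTt
  then have "M = NTt" "M' = NTt"
    by (auto elim: inflation_ttE)
  then show ?case
    using inflation.tt derivable_eq[OF struct_eq.disj_tt] by fastforce
next
  case (NAtom a)
  then show ?case
    using inflation.dup derivable_refl by (metis struct_of.simps(4))
next
  case (NOr N1 N2)
  obtain M1 M2 where M: "M = NOr M1 M2" "inflation M1 N1" "inflation M2 N2"
    using NOr.prems(1) by (auto elim: inflation_disjE)
  obtain M1' M2' where M': "M' = NOr M1' M2'" "inflation M1' N1" "inflation M2' N2"
    using NOr.prems(2) by (auto elim: inflation_disjE)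
  obtain K1 where K1: "inflation K1 N1"
    "derivable contraction_free (disj [struct_of M1, struct_of M1']) (struct_of K1)"
    using NOr.IH(1) M M' by blast
  obtain K2 where K2: "inflation K2 N2"
    "derivable contraction_free (disj [struct_of M2, struct_of M2']) (struct_of K2)"
    using NOr.IH(2) M M' by blast
  have "derivable contraction_free (disj [struct_of M, struct_of M'])
      (disj [disj [struct_of M1, struct_of M1'], disj [struct_of M2, struct_of M2']])"
    by (simp add: M M' derivable_eq disj_exchange)
  also have "derivable contraction_free \<dots> (struct_of (NOr K1 K2))"
    using K1 K2 by (simp add: derivable_disj)
  finally show ?case
    using K1 K2 inflation.disj by blast
next
  case (NAnd N1 N2)
  obtain M1 M2 where M: "M = NAnd M1 M2" "inflation M1 N1" "inflation M2 N2"
    using NAnd.prems(1) by (auto elim: inflation_conjE)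
  obtain M1' M2' where M': "M' = NAnd M1' M2'" "inflation M1' N1" "inflation M2' N2"
    using NAnd.prems(2) by (auto elim: inflation_conjE)
  obtain K1 where K1: "inflation K1 N1"
    "derivable contraction_free (disj [struct_of M1, struct_of M1']) (struct_of K1)"
    using NAnd.IH(1) M M' by blast
  obtain K2 where K2: "inflation K2 N2"
    "derivable contraction_free (disj [struct_of M2, struct_of M2']) (struct_of K2)"
    using NAnd.IH(2) M M' by blast
  have "derivable contraction_free (disj [struct_of M, struct_of M'])
      (conj [disj [struct_of M1, struct_of M1'], disj [struct_of M2, struct_of M2']])"
    by (simp add: M M' derivable_cf_rules)
  also have "derivable contraction_free \<dots> (struct_of (NAnd K1 K2))"
    using K1 K2 by (simp add: derivable_conj)
  finally show ?case
    using K1 K2 inflation.conj by blast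
qed

section \<open>Completeness of the contraction-free system up to inflation\<close>

lemma weakening: "derivable contraction_free Ff (struct_of N)"
proof (induction N)
  case NFf
  show ?case by (simp add: derivable_refl)
next
  case NTt
  \<comment> \<open>Weakening is primitive only for atoms. To reach \<open>Tt\<close>, the unit laws
    pad \<open>Ff\<close> with \<open>disj [Tt, Tt]\<close>, and switch moves one \<open>Tt\<close>
    out of the conjunction.\<close>
  have "derivable contraction_free Ff (conj [Ff, disj [Tt, Tt]])"
    by (rule derivable_eq_sym[OF struct_eq.trans[OF conj_cong[OF struct_eq.refl struct_eq.disj_tt]
            conj_tt_right]])
  also have "derivable contraction_free \<dots> (conj [disj [Tt, Tt], Ff])"
    by (intro derivable_eq struct_eq.conj_comm)
  also have "derivable contraction_free \<dots> (disj [conj [Tt, Ff], Tt])"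
    by (rule derivable_cf_rules)
  also have "derivable contraction_free \<dots> Tt"
    by (rule derivable_eq[OF struct_eq.trans[OF disj_cong[OF struct_eq.conj_tt struct_eq.refl]
            struct_eq.disj_ff]])
  finally show ?case by simp
next
  case (NAtom a)
  show ?case by (simp add: derivable_cf_rules)
next
  case (NOr M N)
  then show ?case
    using derivable_trans[OF derivable_eq_sym[OF struct_eq.disj_ff] derivable_disj] by simp
next
  case (NAnd M N)
  then show ?case
    using derivable_trans[OF derivable_eq_sym[OF struct_eq.conj_ff] derivable_conj] by simp
qed

text \<open>Sequents are encoded as single formulas ending in \<open>NFf\<close>: the empty sequent
  needs no special treatment, and facts on inflations of formulas apply to sequents.\<close>

primrec big_or :: "'v nnf list \<Rightarrow> 'v nnf" where
  "big_or [] = NFf"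
| "big_or (N # \<Gamma>) = NOr N (big_or \<Gamma>)"

abbreviation disj_of :: "'v nnf list \<Rightarrow> 'v struct" where
  "disj_of \<Gamma> \<equiv> struct_of (big_or \<Gamma>)"

lemma disj_of_move: "disj_of (\<Gamma> @ N # \<Lambda>) \<approx> disj_of (N # \<Gamma> @ \<Lambda>)"
proof (induction \<Gamma>)
  case Nil
  show ?case by (simp add: struct_eq.refl)
next
  case (Cons M \<Gamma>)
  then have "disj_of ((M # \<Gamma>) @ N # \<Lambda>) \<approx> disj [struct_of M, disj_of (N # \<Gamma> @ \<Lambda>)]"
    by (simp add: disj_cong struct_eq.refl)
  then show ?case
    using disj_left_comm struct_eq.trans by fastforce
qed

lemma weaken_member:
  "M \<in> set \<Gamma> \<Longrightarrow> derivable contraction_free (struct_of M) (disj_of \<Gamma>)"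
proof (induction \<Gamma>)
  case (Cons N \<Gamma>)
  show ?case
  proof (cases "M = N")
    case True
    have "derivable contraction_free (struct_of M) (disj [struct_of M, Ff])"
      by (rule derivable_eq_sym[OF disj_ff_right])
    also have "derivable contraction_free \<dots> (disj_of (N # \<Gamma>))"
      using True by (simp add: derivable_disj derivable_refl weakening)
    finally show ?thesis .
  next
    case False
    have "derivable contraction_free (struct_of M) (disj [Ff, struct_of M])"
      by (rule derivable_eq_sym[OF struct_eq.disj_ff])
    also have "derivable contraction_free \<dots> (disj_of (N # \<Gamma>))"
      using False Cons by (simp add: derivable_disj weakening)
    finally show ?thesis .
  qed
qed simp

text \<open>Distinctness puts \<open>M\<close> and \<open>M'\<close> at different positions of the
  list, so that each disjunct has its own place and all others are filled by weakening.\<close>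

lemma weaken_members:
  "M \<in> set \<Gamma> \<Longrightarrow> M' \<in> set \<Gamma> \<Longrightarrow> M \<noteq> M' \<Longrightarrow>
    derivable contraction_free (disj [struct_of M, struct_of M']) (disj_of \<Gamma>)"
proof (induction \<Gamma>)
  case (Cons N \<Gamma>)
  consider "N = M" | "N = M'" | "N \<noteq> M" "N \<noteq> M'" by blast
  then show ?case
  proof cases
    case 1
    then show ?thesis
      using Cons.prems by (auto intro!: derivable_disj derivable_refl weaken_member)
  next
    case 2
    have "derivable contraction_free (disj [struct_of M, struct_of M'])
        (disj [struct_of M', struct_of M])"
      by (intro derivable_eq struct_eq.disj_comm)
    also have "derivable contraction_free \<dots> (disj_of (N # \<Gamma>))"
      using 2 Cons.prems by (auto intro!: derivable_disj derivable_refl weaken_member)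
    finally show ?thesis .
  next
    case 3
    have "derivable contraction_free (disj [struct_of M, struct_of M'])
        (disj [Ff, disj [struct_of M, struct_of M']])"
      by (rule derivable_eq_sym[OF struct_eq.disj_ff])
    also have "derivable contraction_free \<dots> (disj_of (N # \<Gamma>))"
      using 3 Cons by (auto intro!: derivable_disj weakening)
    finally show ?thesis .
  qed
qed simp

text \<open>The valuation making \<open>x\<close> true exactly when \<open>Neg x\<close> occurs
  falsifies every negative atom of the clause. The true atom is thus some \<open>Pos x\<close>, and
  its truth says that \<open>Neg x\<close> occurs too.\<close>

lemma valid_clause:
  assumes "\<And>v. \<exists>a \<in> set as. eval_atom v a"
  shows "\<exists>a. a \<in> set as \<and> atom_neg a \<in> set as"
proof -
  obtain a where a: "a \<in> set as" "eval_atom (\<lambda>x. Neg x \<in> set as) a"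
    using assms by blast
  then have "Neg x \<in> set as" if "a = Pos x" for x
    using that by simp
  moreover obtain b where b: "b \<in> set as" "eval_atom (\<lambda>x. Pos x \<notin> set as) b"
    using assms by blast
  ultimately show ?thesis
    using a by (cases a; cases b) (auto intro: bexI[of _ a] exI[of _ a])
qed

lemma inflation_list_merge:
  assumes "list_all2 inflation \<Gamma> \<Lambda>" "list_all2 inflation \<Gamma>' \<Lambda>"
  shows "\<exists>\<Omega>. list_all2 inflation \<Omega> \<Lambda> \<and>
    derivable contraction_free (disj [disj_of \<Gamma>, disj_of \<Gamma>']) (disj_of \<Omega>)"
proof -
  have big: "inflation (big_or \<Gamma>) (big_or \<Lambda>)" if "list_all2 inflation \<Gamma> \<Lambda>" for \<Gamma> :: "'a nnf list"
    using that by (induction rule: list_all2_induct) (auto intro: inflation.intros)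
  \<comment> \<open>Inflating \<open>NOr\<close> or \<open>NFf\<close> preserves the outer shape, so
    the merged formula again decomposes as a sequent of the same length.\<close>
  have unbig: "\<exists>\<Omega>. K = big_or \<Omega> \<and> list_all2 inflation \<Omega> \<Lambda>" if "inflation K (big_or \<Lambda>)" for K
    using that
  proof (induction \<Lambda> arbitrary: K rule: list.induct)
    case Nil
    then show ?case by (auto elim: inflation_ffE intro: exI[of _ "[]"])
  next
    case (Cons N \<Lambda>)
    then show ?case
      by (fastforce elim!: inflation_disjE simp: list_all2_Cons2 dest: Cons.IH
          intro: exI[of _ "_ # _"])
  qed
  show ?thesis
    using inflation_merge[OF big[OF assms(1)] big[OF assms(2)]] unbig by blast
qed

text \<open>The atoms in \<open>as\<close> have already been processed by the proof search.\<close>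

lemma valid_imp_inflation_derivable:
  assumes "\<And>v. \<exists>N \<in> set (\<Gamma> @ map NAtom as). eval_nnf v N"
  shows "\<exists>\<Omega>. list_all2 inflation \<Omega> (\<Gamma> @ map NAtom as) \<and> derivable contraction_free Tt (disj_of \<Omega>)"
  using assms
\<comment> \<open>Each list cell contributes one to \<open>size_list\<close>. Splitting a
  disjunction adds a cell, and doubling the sizes makes the measure decrease nevertheless.\<close>
proof (induction "size_list (\<lambda>N. 2 * size N) \<Gamma>" arbitrary: \<Gamma> as rule: less_induct)
  case less
  have refl: "list_all2 inflation \<Omega> \<Omega>" for \<Omega> :: "'a nnf list"
    by (simp add: list_all2_refl inflation_refl)
  show ?case
  proof (cases \<Gamma>)
    case Nil
    then have "\<exists>a \<in> set as. eval_atom v a" for v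
      using less.prems[of v] by auto
    then obtain a where a: "a \<in> set as" "atom_neg a \<in> set as"
      using valid_clause by blast
    \<comment> \<open>Only atoms are left, so the proof search ends in an identity axiom; the
      remaining atoms come from weakening.\<close>
    have "derivable contraction_free Tt (disj [Atom a, Bar (Atom a)])"
      by (rule derivable_cf_rules)
    also have "derivable contraction_free \<dots>
        (disj [struct_of (NAtom a), struct_of (NAtom (atom_neg a))])"
      by (simp add: derivable_disj derivable_refl derivable_eq struct_eq.bar_atom)
    also have "derivable contraction_free \<dots> (disj_of (map NAtom as))"
      using a by (intro weaken_members) (cases a; auto)+
    finally show ?thesis
      using refl Nil by auto
  next
    case (Cons N \<Lambda>)
    let ?\<Lambda> = "\<Lambda> @ map NAtom as"
    show ?thesis
    proof (cases N)
      case NFf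
      have "\<exists>N \<in> set ?\<Lambda>. eval_nnf v N" for v
        using less.prems[of v] Cons NFf by auto
      then obtain \<Omega> where \<Omega>: "list_all2 inflation \<Omega> ?\<Lambda>" "derivable contraction_free Tt (disj_of \<Omega>)"
        using less.hyps[of \<Lambda> as] Cons by auto
      have "derivable contraction_free Tt (disj_of (NFf # \<Omega>))"
        using derivable_trans[OF \<Omega>(2) derivable_eq_sym[OF struct_eq.disj_ff]] by simp
      then show ?thesis
        using \<Omega>(1) Cons NFf inflation.ff by (intro exI[of _ "NFf # \<Omega>"]) simp
    next
      case NTt
      then have "derivable contraction_free Tt (disj_of (\<Gamma> @ map NAtom as))"
        using weaken_member[of NTt "\<Gamma> @ map NAtom as"] Cons by simp
      then show ?thesis
        using refl by blast
    next
      case (NAtom a)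
      have "\<exists>N \<in> set (\<Lambda> @ map NAtom (a # as)). eval_nnf v N" for v
        using less.prems[of v] Cons NAtom by auto
      then obtain \<Omega> where \<Omega>: "list_all2 inflation \<Omega> (\<Lambda> @ NAtom a # map NAtom as)"
        "derivable contraction_free Tt (disj_of \<Omega>)"
        using less.hyps[of \<Lambda> "a # as"] Cons by auto
      \<comment> \<open>The inflation \<open>M\<close> of the atom lies between those of
        \<open>\<Lambda>\<close> and of the atoms processed earlier; commutativity brings it back to
        the front.\<close>
      then obtain \<Lambda>' M \<Theta> where split: "\<Omega> = \<Lambda>' @ M # \<Theta>" "list_all2 inflation \<Lambda>' \<Lambda>"
        "inflation M (NAtom a)" "list_all2 inflation \<Theta> (map NAtom as)"
        by (auto simp: list_all2_append2 list_all2_Cons2)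
      have "derivable contraction_free Tt (disj_of (M # \<Lambda>' @ \<Theta>))"
        using derivable_trans[OF \<Omega>(2) derivable_eq] disj_of_move split(1) by blast
      then show ?thesis
        using split Cons NAtom
        by (intro exI[of _ "M # \<Lambda>' @ \<Theta>"]) (auto intro: list_all2_appendI)
    next
      case (NOr N1 N2)
      have "\<exists>N \<in> set ((N1 # N2 # \<Lambda>) @ map NAtom as). eval_nnf v N" for v
        using less.prems[of v] Cons NOr by auto
      then obtain \<Omega> where \<Omega>: "list_all2 inflation \<Omega> (N1 # N2 # ?\<Lambda>)"
        "derivable contraction_free Tt (disj_of \<Omega>)"
        using less.hyps[of "N1 # N2 # \<Lambda>" as] Cons NOr by auto
      then obtain M1 M2 \<Theta> where split: "\<Omega> = M1 # M2 # \<Theta>"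
        "inflation M1 N1" "inflation M2 N2" "list_all2 inflation \<Theta> ?\<Lambda>"
        by (auto simp: list_all2_Cons2)
      have "derivable contraction_free Tt (disj_of (NOr M1 M2 # \<Theta>))"
        using derivable_trans[OF \<Omega>(2) derivable_eq_sym] disj_assoc2 split(1) by auto
      then show ?thesis
        using split Cons NOr
        by (intro exI[of _ "NOr M1 M2 # \<Theta>"]) (auto intro: inflation.disj)
    next
      case (NAnd N1 N2)
      have "\<exists>N \<in> set ((N1 # \<Lambda>) @ map NAtom as). eval_nnf v N" for v
        using less.prems[of v] Cons NAnd by auto
      then obtain \<Omega>1 where \<Omega>1: "list_all2 inflation \<Omega>1 (N1 # ?\<Lambda>)"
        "derivable contraction_free Tt (disj_of \<Omega>1)"
        using less.hyps[of "N1 # \<Lambda>" as] Cons NAnd by auto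
      have "\<exists>N \<in> set ((N2 # \<Lambda>) @ map NAtom as). eval_nnf v N" for v
        using less.prems[of v] Cons NAnd by auto
      then obtain \<Omega>2 where \<Omega>2: "list_all2 inflation \<Omega>2 (N2 # ?\<Lambda>)"
        "derivable contraction_free Tt (disj_of \<Omega>2)"
        using less.hyps[of "N2 # \<Lambda>" as] Cons NAnd by auto
      obtain M1 \<Theta>1 where split1: "\<Omega>1 = M1 # \<Theta>1" "inflation M1 N1" "list_all2 inflation \<Theta>1 ?\<Lambda>"
        using \<Omega>1 by (auto simp: list_all2_Cons2)
      obtain M2 \<Theta>2 where split2: "\<Omega>2 = M2 # \<Theta>2" "inflation M2 N2" "list_all2 inflation \<Theta>2 ?\<Lambda>"
        using \<Omega>2 by (auto simp: list_all2_Cons2)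
      obtain \<Theta> where \<Theta>: "list_all2 inflation \<Theta> ?\<Lambda>"
        "derivable contraction_free (disj [disj_of \<Theta>1, disj_of \<Theta>2]) (disj_of \<Theta>)"
        using inflation_list_merge[OF split1(3) split2(3)] by blast
      let ?M1 = "struct_of M1" and ?M2 = "struct_of M2"
      \<comment> \<open>The two premises are proved side by side in a conjunction. Two switches take
        out their side formulas \<open>\<Theta>1\<close> and \<open>\<Theta>2\<close>, leaving the
        conjunction of \<open>M1\<close> and \<open>M2\<close> next to both copies, which then merge
        into \<open>\<Theta>\<close>.\<close>
      have "derivable contraction_free Tt (conj [Tt, Tt])"
        by (rule derivable_eq_sym[OF struct_eq.conj_tt])
      also have "derivable contraction_free \<dots> (conj [disj [?M1, disj_of \<Theta>1], disj_of \<Omega>2])"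
        using \<Omega>1(2) \<Omega>2(2) split1(1) by (simp add: derivable_conj)
      also have "derivable contraction_free \<dots> (disj [conj [?M1, disj_of \<Omega>2], disj_of \<Theta>1])"
        by (rule derivable_cf_rules)
      also have "derivable contraction_free \<dots>
          (disj [conj [disj [?M2, disj_of \<Theta>2], ?M1], disj_of \<Theta>1])"
        using split2(1)
        by (auto intro!: derivable_disj derivable_refl derivable_eq[OF struct_eq.conj_comm])
      also have "derivable contraction_free \<dots>
          (disj [disj [conj [?M2, ?M1], disj_of \<Theta>2], disj_of \<Theta>1])"
        by (intro derivable_disj derivable_refl derivable_cf_rules)
      also have "derivable contraction_free \<dots>
          (disj [conj [?M2, ?M1], disj [disj_of \<Theta>2, disj_of \<Theta>1]])"
        by (intro derivable_eq disj_assoc2)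
      also have "derivable contraction_free \<dots>
          (disj [conj [?M1, ?M2], disj [disj_of \<Theta>1, disj_of \<Theta>2]])"
        by (intro derivable_eq disj_cong struct_eq.conj_comm struct_eq.disj_comm)
      also have "derivable contraction_free \<dots> (disj_of (NAnd M1 M2 # \<Theta>))"
        using \<Theta>(2) by (simp add: derivable_disj derivable_refl)
      finally show ?thesis
        using \<Theta>(1) split1 split2 Cons NAnd
        by (intro exI[of _ "NAnd M1 M2 # \<Theta>"]) (auto intro: inflation.conj)
    qed
  qed
qed

section \<open>The general cut and the decomposition\<close>

lemma switch_left:
  "derivable contraction_free (conj [T, disj [R, U]]) (disj [conj [T, R], U])"
proof -
  have "derivable contraction_free (conj [T, disj [R, U]]) (conj [disj [R, U], T])"
    by (intro derivable_eq struct_eq.conj_comm)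
  also have "derivable contraction_free \<dots> (disj [conj [R, T], U])"
    by (rule derivable_cf_rules)
  also have "derivable contraction_free \<dots> (disj [conj [T, R], U])"
    by (intro derivable_eq disj_cong struct_eq.conj_comm struct_eq.refl)
  finally show ?thesis .
qed

text \<open>Switch moves \<open>P\<close> next to \<open>P'\<close> inside the disjunction, where
  the two cancel to \<open>Ff\<close>; what remains is \<open>Q\<close> against
  \<open>Q'\<close>.\<close>

lemma cut_step:
  assumes "derivable contraction_free (conj [P, P']) Ff" "derivable contraction_free (conj [Q, Q']) Ff"
  shows "derivable contraction_free (conj [conj [P, Q], disj [P', Q']]) Ff"
proof -
  have "derivable contraction_free (conj [conj [P, Q], disj [P', Q']])
      (conj [conj [Q, P], disj [P', Q']])"
    by (intro derivable_eq conj_cong struct_eq.conj_comm struct_eq.refl)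
  also have "derivable contraction_free \<dots> (conj [Q, conj [P, disj [P', Q']]])"
    by (intro derivable_eq conj_assoc2)
  also have "derivable contraction_free \<dots> (conj [Q, disj [conj [P, P'], Q']])"
    by (intro derivable_conj derivable_refl switch_left)
  also have "derivable contraction_free \<dots> (conj [Q, disj [Ff, Q']])"
    using assms(1) by (intro derivable_conj derivable_disj derivable_refl)
  also have "derivable contraction_free \<dots> (conj [Q, Q'])"
    by (intro derivable_eq conj_cong struct_eq.refl struct_eq.disj_ff)
  also have "derivable contraction_free \<dots> Ff"
    by (rule assms(2))
  finally show ?thesis .
qed

text \<open>\<open>Ai_up\<close> cuts atoms only; \<open>cut_step\<close> reduces a cut on a
  compound formula to cuts on its components.\<close>

lemma general_cut: "derivable contraction_free (conj [struct_of N, struct_of (neg N)]) Ff"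
proof (induction N)
  case NFf
  show ?case by (simp add: derivable_eq conj_tt_right)
next
  case NTt
  show ?case by (simp add: derivable_eq struct_eq.conj_tt)
next
  case (NAtom a)
  have "derivable contraction_free (conj [Atom a, Atom (atom_neg a)]) (conj [Atom a, Bar (Atom a)])"
    by (intro derivable_eq_sym conj_cong struct_eq.refl struct_eq.bar_atom)
  also have "derivable contraction_free \<dots> Ff"
    by (rule derivable_cf_rules)
  finally show ?case by simp
next
  case (NOr M N)
  \<comment> \<open>For \<open>NOr\<close> the disjunction is the left conjunct, whereas
    \<open>cut_step\<close> has it on the right, so the conjuncts are swapped.\<close>
  have comm: "derivable contraction_free (conj [Q, P]) R"
    if "derivable contraction_free (conj [P, Q]) R" for P Q R :: "'a struct"
    using that by (rule derivable_trans[OF derivable_eq[OF struct_eq.conj_comm]])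
  from NOr show ?case
    by (auto intro: comm cut_step)
next
  case (NAnd M N)
  then show ?case by (simp add: cut_step)
qed

section \<open>Assembling the three phases\<close>

theorem theorem3p33:
  fixes T R :: "'v struct" and \<Delta> :: "(rule \<times> 'v struct \<times> 'v struct) list"
  assumes "derivation SKS T \<Delta> R"
  shows "\<exists>V U \<Delta>\<^sub>1 \<Delta>\<^sub>2 \<Delta>\<^sub>3.
    derivation SKS T (\<Delta>\<^sub>1 @ \<Delta>\<^sub>2 @ \<Delta>\<^sub>3) R \<and>
    derivation {Ac_up} T \<Delta>\<^sub>1 V \<and>
    derivation (SKS - {Ac_down, Ac_up}) V \<Delta>\<^sub>2 U \<and>
    derivation {Ac_down} U \<Delta>\<^sub>3 R"
proof -
  obtain M where M: "struct_of M \<approx> T"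
    using ex_nnf by blast
  obtain N where N: "struct_of N \<approx> R"
    using ex_nnf by blast
  have "eval_nnf v (neg M) \<or> eval_nnf v N" for v
    using derivation_sound[OF assms, of v] eval_struct_eq[OF M, of v] eval_struct_eq[OF N, of v]
    by (auto simp: eval_nnf_neg)
  then obtain \<Omega> where "list_all2 inflation \<Omega> [neg M, N]"
    and \<Omega>: "derivable contraction_free Tt (disj_of \<Omega>)"
    using valid_imp_inflation_derivable[of "[neg M, N]" "[]"] by auto
  then obtain X Y where X: "inflation X (neg M)" and Y: "inflation Y N" and "\<Omega> = [X, Y]"
    by (auto simp: list_all2_Cons2)
  with \<Omega> have XY: "derivable contraction_free Tt (disj [struct_of X, disj [struct_of Y, Ff]])"
    by simp
  \<comment> \<open>As \<open>X\<close> inflates \<open>neg M\<close>, its negation is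
    \<open>M\<close> with atoms replaced by conjunctions of copies, hence within reach of
    cocontraction from \<open>T\<close>.\<close>
  define V where "V = struct_of (neg X)"
  have "derivable {Ac_up} T (struct_of M)"
    by (rule derivable_eq_sym[OF M])
  also have "derivable {Ac_up} \<dots> V"
    using inflation_ac_up[OF X] by (simp add: V_def)
  finally have up: "derivable {Ac_up} T V" .
  \<comment> \<open>The proof of the disjunction of \<open>X\<close> and \<open>Y\<close> is placed
    beside \<open>V\<close>; switch brings \<open>V\<close> to its negation \<open>X\<close>, and
    the cut leaves \<open>Y\<close>, which serves as \<open>U\<close>.\<close>
  have "derivable contraction_free V (conj [V, Tt])"
    by (rule derivable_eq_sym[OF conj_tt_right])
  also have "derivable contraction_free \<dots> (conj [V, disj [struct_of X, disj [struct_of Y, Ff]]])"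
    using XY by (intro derivable_conj derivable_refl)
  also have "derivable contraction_free \<dots> (disj [conj [V, struct_of X], disj [struct_of Y, Ff]])"
    by (rule switch_left)
  also have "derivable contraction_free \<dots> (disj [Ff, struct_of Y])"
    \<comment> \<open>The cut formula is \<open>neg X\<close>, whose negation
      \<open>neg (neg X)\<close> simplifies to \<open>X\<close>.\<close>
    using general_cut[of "neg X"]
    by (intro derivable_disj) (simp_all add: V_def derivable_eq disj_ff_right)
  also have "derivable contraction_free \<dots> (struct_of Y)"
    by (intro derivable_eq struct_eq.disj_ff)
  finally have mid: "derivable contraction_free V (struct_of Y)" .
  have "derivable {Ac_down} (struct_of Y) (struct_of N)"
    by (rule inflation_ac_down[OF Y])
  also have "derivable {Ac_down} \<dots> R"
    by (rule derivable_eq[OF N])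
  finally have down: "derivable {Ac_down} (struct_of Y) R" .
  from up mid down obtain \<Delta>\<^sub>1 \<Delta>\<^sub>2 \<Delta>\<^sub>3 where parts: "derivation {Ac_up} T \<Delta>\<^sub>1 V"
    "derivation contraction_free V \<Delta>\<^sub>2 (struct_of Y)" "derivation {Ac_down} (struct_of Y) \<Delta>\<^sub>3 R"
    unfolding derivable_def by blast
  have "{Ac_up} \<subseteq> SKS" "contraction_free \<subseteq> SKS" "{Ac_down} \<subseteq> SKS"
    by (auto simp: SKS_def)
  with parts have "derivation SKS T (\<Delta>\<^sub>1 @ \<Delta>\<^sub>2 @ \<Delta>\<^sub>3) R"
    by (meson derivation_append derivation_mono)
  with parts show ?thesis by blast
qed

end
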